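(* Let $f,g\in\mathbb{C}[x,y]$, let $m\ge2$ be the degree of the polynomial vector field $(f,g)$, and consider $\dot x(t)=f(x,y)$, $\dot y(t)=g(x,y)$ in complex time $t$. In blow-up coordinates $u=1/x$ and $z$ (the coordinate $y/x$, shifted so that a blow-up equilibrium $(0,e)$ is at $u=z=0$, and linearly transformed so that the linearization there is diagonal), with rescaled time $dt=u^{m-1}dt_1$, the system takes the polynomial form $$\frac{du}{dt_1}=f^u(u,z)=u(\lambda_1+\dots),\qquad \frac{dz}{dt_1}=f^z(u,z)=z(\lambda_2+\dots)+u^2(c_2+\dots)$$ with higher order terms in $u,z$ omitted, $c_2\in\mathbb{C}$, and real eigenvalues $\lambda_1<0\neq\lambda_2$, $\lambda_1/\lambda_2\neq 1$. Assume a trivial stable leaf $\mathcal{L}\subset\{z=0\neq u\}$ exists, associated to the stable eigenvalue $\lambda_1<0$ of the linearization at the equilibrium $u=z=0$. Then any local loop $\gamma^u$ of $u\in\mathcal{L}\setminus\{0\}$ with winding number $\mathfrak{w}_u=1$ (around $u=0$) defines a minimal blow-up loop $(\gamma^t,\gamma^u)$. Its winding number is $\mathfrak{w}(\gamma^t)=m-1$.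
   Context: Before shift and diagonalization, the blow-up equation is $\frac{du}{dt_1}=-u f_1(u,z)$, $\frac{dz}{dt_1}=-zf_1(u,z)+g_1(u,z)$ with $u=1/x$, $z=y/x$, $f_1(u,z)=u^mf(1/u,z/u)$, $g_1(u,z)=u^mg(1/u,z/u)$. A leaf is a nonstationary solution orbit in complex time. Existence of the trivial stable leaf means that, locally, $\{z=0\}$ is invariant under the flow, with $\mathcal{L}$ the punctured neighborhood of $0$ in the $u$-plane $\{z=0\}$. On $\mathcal{L}$, solutions are parametrized by original time $t$ via $dt=u^{m-1}dt_1$, and blow-up means $u\to0$ as $t\to T=0$. Blow-up loop: let $\gamma^t:[0,2\pi]\to\mathbb{C}\setminus\{T\}$, $s\mapsto t(s)$, be a closed curve near $T$ with nonzero (without loss of generality positive) winding number $\mathfrak{w}(\gamma^t)$ around $T$. The pair consisting of $\gamma^t$ and the solution curve $s\mapsto(u(t(s)),z(t(s)))\in\mathcal{L}$ continued along $\gamma^t$ is a blow-up loop if this solution curve closes up, i.e. takes the same value at $s=2\pi$ and $s=0$. It is minimal if $\mathfrak{w}(\gamma^t)>0$ is minimal among all blow-up loops in the local leaf $\mathcal{L}$. On the leaf $z=0$ the solution curve is identified with its $u$-component $\gamma^u$. *)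

theory Defs
  imports "HOL-Complex_Analysis.Complex_Analysis" "HOL-Computational_Algebra.Computational_Algebra"
begin

text \<open>Elements of \<open>\<complex>[x,y]\<close> are represented in \<open>\<complex>[x][y]\<close>: the coefficient of \<open>x\<^sup>i y\<^sup>j\<close> in \<open>p\<close> is
  \<open>coeff (coeff p j) i\<close>.\<close>

definition poly2 :: "complex poly poly \<Rightarrow> complex \<Rightarrow> complex \<Rightarrow> complex" where
  "poly2 p x y = poly (poly p [:y:]) x"

definition total_degree :: "complex poly poly \<Rightarrow> nat" where
  "total_degree p = Max (insert 0 {i + j |i j. coeff (coeff p j) i \<noteq> 0})"

definition vf_degree :: "complex poly poly \<Rightarrow> complex poly poly \<Rightarrow> nat" where
  "vf_degree f g = max (total_degree f) (total_degree g)"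

text \<open>The polynomial \<open>u\<^sup>m p(1/u, w/u)\<close>, written out monomial by monomial so that it also makes
  sense at \<open>u = 0\<close>; see \<open>blowup_poly_eq\<close> below.\<close>

definition blowup_poly :: "nat \<Rightarrow> complex poly poly \<Rightarrow> complex \<Rightarrow> complex \<Rightarrow> complex" where
  "blowup_poly m p u w = (\<Sum>j\<le>m. \<Sum>i\<le>m - j. coeff (coeff p j) i * u ^ (m - i - j) * w ^ j)"

text \<open>The blow-up coordinates are \<open>u = 1/x\<close> and \<open>z\<close>, where \<open>y/x = e + k u + c z\<close> with \<open>c \<noteq> 0\<close>: the
  equilibrium \<open>(0,e)\<close> is shifted to the origin, and \<open>k\<close>, \<open>c\<close> give the general linear change of
  coordinates that keeps \<open>u\<close>. In terms of \<open>w = y/x\<close> the equations in rescaled time \<open>t\<^sub>1\<close> are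
  \<open>u' = - u f\<^sub>1(u,w)\<close> and \<open>w' = - w f\<^sub>1(u,w) + g\<^sub>1(u,w)\<close>; hence \<open>z' = (w' - k u') / c\<close>.\<close>

definition field_u ::
  "nat \<Rightarrow> complex poly poly \<Rightarrow> complex \<Rightarrow> complex \<Rightarrow> complex \<Rightarrow> complex \<Rightarrow> complex \<Rightarrow> complex" where
  "field_u m f e k c u z = - u * blowup_poly m f u (e + k * u + c * z)"

definition field_z ::
  "nat \<Rightarrow> complex poly poly \<Rightarrow> complex poly poly \<Rightarrow> complex \<Rightarrow> complex \<Rightarrow> complex \<Rightarrow> complex \<Rightarrow> complex \<Rightarrow> complex"
  where
  "field_z m f g e k c u z =
     (let w = e + k * u + c * z
      in (- w * blowup_poly m f u w + blowup_poly m g u w - k * field_u m f e k c u z) / c)"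

text \<open>\<open>F(u,z) = u (\<lambda>\<^sub>1 + \<dots>)\<close> and \<open>G(u,z) = z (\<lambda>\<^sub>2 + \<dots>) + u\<^sup>2 (c\<^sub>2 + \<dots>)\<close>, where the dots are polynomials
  in \<open>u, z\<close> without constant term.\<close>

definition blowup_form ::
  "(complex \<Rightarrow> complex \<Rightarrow> complex) \<Rightarrow> (complex \<Rightarrow> complex \<Rightarrow> complex) \<Rightarrow> real \<Rightarrow> real \<Rightarrow> complex \<Rightarrow> bool" where
  "blowup_form F G l1 l2 c2 \<longleftrightarrow>
     (\<exists>P Q R. poly2 P 0 0 = 0 \<and> poly2 Q 0 0 = 0 \<and> poly2 R 0 0 = 0 \<and>
        (\<forall>u z. F u z = u * (of_real l1 + poly2 P u z) \<and>
               G u z = z * (of_real l2 + poly2 Q u z) + u\<^sup>2 * (c2 + poly2 R u z)))"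

definition complex_solution ::
  "(complex \<Rightarrow> complex \<Rightarrow> complex) \<Rightarrow> (complex \<Rightarrow> complex \<Rightarrow> complex) \<Rightarrow> complex set \<Rightarrow>
   (complex \<Rightarrow> complex) \<Rightarrow> (complex \<Rightarrow> complex) \<Rightarrow> bool" where
  "complex_solution F G S U Z \<longleftrightarrow>
     (\<forall>t\<in>S. (U has_field_derivative F (U t) (Z t)) (at t) \<and>
            (Z has_field_derivative G (U t) (Z t)) (at t))"

text \<open>The field \<open>F\<close>, given in rescaled time \<open>t\<^sub>1\<close>, in original time \<open>t\<close>, where \<open>dt = u\<^bsup>m-1\<^esup> dt\<^sub>1\<close>.\<close>

definition orig_time ::
  "nat \<Rightarrow> (complex \<Rightarrow> complex \<Rightarrow> complex) \<Rightarrow> complex \<Rightarrow> complex \<Rightarrow> complex" where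
  "orig_time m F u z = F u z / u ^ (m - 1)"

text \<open>The set \<open>L\<close> of \<open>u\<close>-values stands for \<open>{(u,0). u \<in> L}\<close>. Invariance under the local flow
  in \<open>t\<^sub>1\<close> says that the solution through each point of \<open>L\<close> (unique, as \<open>F\<close> and \<open>G\<close> are
  polynomial) stays in \<open>L\<close> for small complex times; it must not be stationary. The leaf is the
  one of \<open>\<lambda>\<^sub>1\<close>, because the \<open>u\<close>-axis is the eigenspace of \<open>\<lambda>\<^sub>1\<close> in \<open>blowup_form\<close>.\<close>

definition trivial_leaf ::
  "(complex \<Rightarrow> complex \<Rightarrow> complex) \<Rightarrow> (complex \<Rightarrow> complex \<Rightarrow> complex) \<Rightarrow> complex set \<Rightarrow> bool" where
  "trivial_leaf F G L \<longleftrightarrow>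
     (\<exists>D. open D \<and> connected D \<and> 0 \<in> D \<and> L = D - {0}) \<and>
     (\<forall>u0\<in>L. \<exists>r>0. \<exists>U Z. complex_solution F G (ball 0 r) U Z \<and> U 0 = u0 \<and>
        (\<forall>\<tau>\<in>ball 0 r. U \<tau> \<in> L \<and> Z \<tau> = 0) \<and> \<not> U constant_on ball 0 r)"

text \<open>The curve \<open>s \<mapsto> (a s, b s)\<close>, for \<open>s \<in> I\<close>, is a solution in original time continued along the
  time curve \<open>\<gamma>\<close>: near each \<open>s\<close>, its values are those of one solution germ at \<open>\<gamma> s\<close>. Neighbouring
  germs agree by uniqueness of solutions.\<close>

definition solution_along ::
  "nat \<Rightarrow> (complex \<Rightarrow> complex \<Rightarrow> complex) \<Rightarrow> (complex \<Rightarrow> complex \<Rightarrow> complex) \<Rightarrow> real set \<Rightarrow>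
   (real \<Rightarrow> complex) \<Rightarrow> (real \<Rightarrow> complex) \<Rightarrow> (real \<Rightarrow> complex) \<Rightarrow> bool" where
  "solution_along m F G I \<gamma> a b \<longleftrightarrow>
     (\<forall>s\<in>I. \<exists>r>0. \<exists>\<delta>>0. \<exists>U Z.
        complex_solution (orig_time m F) (orig_time m G) (ball (\<gamma> s) r) U Z \<and>
        (\<forall>t\<in>ball (\<gamma> s) r. U t \<noteq> 0) \<and>
        (\<forall>s'\<in>I. \<bar>s' - s\<bar> < \<delta> \<longrightarrow>
           \<gamma> s' \<in> ball (\<gamma> s) r \<and> a s' = U (\<gamma> s') \<and> b s' = Z (\<gamma> s')))"

text \<open>The solution on the leaf with value \<open>u0\<close> at time \<open>t0\<close> has blow-up time \<open>T\<close>: along some time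
  path from \<open>t0\<close> to \<open>T\<close> it can be continued within \<open>L\<close>, with \<open>u \<rightarrow> 0\<close> as \<open>t \<rightarrow> T\<close>. This ties \<open>T\<close> to
  the solution; in general solutions are ramified at \<open>T\<close>, so they are not functions on a
  punctured neighbourhood of \<open>T\<close>.\<close>

definition blows_up_at ::
  "nat \<Rightarrow> (complex \<Rightarrow> complex \<Rightarrow> complex) \<Rightarrow> (complex \<Rightarrow> complex \<Rightarrow> complex) \<Rightarrow> complex set \<Rightarrow>
   complex \<Rightarrow> complex \<Rightarrow> complex \<Rightarrow> bool" where
  "blows_up_at m F G L T t0 u0 \<longleftrightarrow>
     (\<exists>\<eta> \<mu>. path \<eta> \<and> pathstart \<eta> = t0 \<and> pathfinish \<eta> = T \<and> \<mu> 0 = u0 \<and>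
        \<mu> ` {0..<1} \<subseteq> L \<and> solution_along m F G {0..<1} \<eta> \<mu> (\<lambda>_. 0) \<and>
        (\<mu> \<longlongrightarrow> 0) (at_left 1))"

text \<open>Curves are parametrized over \<open>[0,1]\<close>, as in the library, instead of \<open>[0,2\<pi>]\<close>. On the leaf
  the solution curve \<open>(u,z) = (\<gamma>u, 0)\<close> is identified with \<open>\<gamma>u\<close>.\<close>

definition blowup_loop ::
  "nat \<Rightarrow> (complex \<Rightarrow> complex \<Rightarrow> complex) \<Rightarrow> (complex \<Rightarrow> complex \<Rightarrow> complex) \<Rightarrow> complex set \<Rightarrow>
   complex \<Rightarrow> (real \<Rightarrow> complex) \<Rightarrow> (real \<Rightarrow> complex) \<Rightarrow> bool" where
  "blowup_loop m F G L T \<gamma>t \<gamma>u \<longleftrightarrow>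
     path \<gamma>t \<and> pathfinish \<gamma>t = pathstart \<gamma>t \<and> T \<notin> path_image \<gamma>t \<and> winding_number \<gamma>t T \<noteq> 0 \<and>
     path_image \<gamma>u \<subseteq> L \<and> solution_along m F G {0..1} \<gamma>t \<gamma>u (\<lambda>_. 0) \<and>
     blows_up_at m F G L T (pathstart \<gamma>t) (pathstart \<gamma>u) \<and>
     pathfinish \<gamma>u = pathstart \<gamma>u"

definition minimal_blowup_loop ::
  "nat \<Rightarrow> (complex \<Rightarrow> complex \<Rightarrow> complex) \<Rightarrow> (complex \<Rightarrow> complex \<Rightarrow> complex) \<Rightarrow> complex set \<Rightarrow>
   complex \<Rightarrow> (real \<Rightarrow> complex) \<Rightarrow> (real \<Rightarrow> complex) \<Rightarrow> bool" where
  "minimal_blowup_loop m F G L T \<gamma>t \<gamma>u \<longleftrightarrow>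
     blowup_loop m F G L T \<gamma>t \<gamma>u \<and> 0 < Re (winding_number \<gamma>t T) \<and>
     (\<forall>T' \<gamma>t' \<gamma>u'. blowup_loop m F G L T' \<gamma>t' \<gamma>u' \<and> 0 < Re (winding_number \<gamma>t' T') \<longrightarrow>
        Re (winding_number \<gamma>t T) \<le> Re (winding_number \<gamma>t' T'))"

lemma total_degree_ge:
  assumes "coeff (coeff p j) i \<noteq> 0" shows "i + j \<le> total_degree p"
proof -
  let ?S = "{i + j |i j. coeff (coeff p j) i \<noteq> 0}"
  let ?N = "\<Sum>j\<le>degree p. degree (coeff p j)"
  have "?S \<subseteq> {..?N + degree p}"
  proof
    fix n assume "n \<in> ?S"
    then obtain i j where n: "n = i + j" and ij: "coeff (coeff p j) i \<noteq> 0" by blast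
    have j: "j \<le> degree p" using ij by (metis coeff_0 le_degree)
    have "i \<le> degree (coeff p j)" using ij by (rule le_degree)
    also have "\<dots> \<le> ?N" by (rule member_le_sum) (use j in auto)
    finally show "n \<in> {..?N + degree p}" using n j by simp
  qed
  then have "finite ?S" using finite_subset by blast
  then show ?thesis unfolding total_degree_def using assms by (intro Max_ge) auto
qed

lemma blowup_poly_eq:
  assumes "u \<noteq> 0" and m: "total_degree p \<le> m"
  shows "blowup_poly m p u w = u ^ m * poly2 p (1 / u) (w / u)"
proof -
  have z: "coeff (coeff p j) i = 0" if "i + j > m" for i j
    using total_degree_ge[of p j i] that m by linarith
  have zj: "coeff p j = 0" if "j > m" for j
    by (rule poly_eqI) (use z that in auto)
  have deg: "degree p \<le> m" using zj by (simp add: degree_le)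
  have degj: "degree (coeff p j) \<le> m - j" for j
    by (rule degree_le) (use z in auto)
  have poly_bd: "poly q x = (\<Sum>i\<le>n. coeff q i * x ^ i)" if "degree q \<le> n"
    for q :: "complex poly" and x n
    unfolding poly_altdef
    by (rule sum.mono_neutral_left) (use that in \<open>auto simp: coeff_eq_0\<close>)
  have "poly2 p (1/u) (w/u) = (\<Sum>j\<le>m. poly (coeff p j) (1/u) * (w/u)^j)"
    unfolding poly2_def poly_altdef[of p]
    by (subst sum.mono_neutral_left[of "{..m}" "{..degree p}"])
       (use deg in \<open>auto simp: poly_sum coeff_eq_0\<close>)
  also have "\<dots> = (\<Sum>j\<le>m. \<Sum>i\<le>m-j. coeff (coeff p j) i * (1/u)^i * (w/u)^j)"
    by (intro sum.cong refl) (simp only: poly_bd[OF degj] sum_distrib_right)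
  finally have eq: "poly2 p (1/u) (w/u) =
      (\<Sum>j\<le>m. \<Sum>i\<le>m-j. coeff (coeff p j) i * (1/u)^i * (w/u)^j)" .
  have term_eq: "a * u ^ (m - i - j) * w ^ j = u ^ m * (a * (1/u)^i * (w/u)^j)"
    if "j \<le> m" "i \<le> m - j" for a i j
  proof -
    have "u ^ m = u ^ (m - i - j) * u ^ i * u ^ j"
      using that by (simp flip: power_add)
    then show ?thesis using assms(1) by (simp add: power_divide)
  qed
  show ?thesis
    unfolding blowup_poly_def eq sum_distrib_left
    by (intro sum.cong refl term_eq) auto
qed

text \<open>The blow-up equations in original time are the system \<open>x' = f(x,y)\<close>, \<open>y' = g(x,y)\<close>.\<close>

lemma complex_solution_blowup_iff:
  fixes U Z :: "complex \<Rightarrow> complex"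
  assumes m: "m = vf_degree f g" "m \<ge> 1" and "c \<noteq> 0" "open S" and U0: "\<And>t. t \<in> S \<Longrightarrow> U t \<noteq> 0"
  shows "complex_solution (orig_time m (field_u m f e k c)) (orig_time m (field_z m f g e k c)) S U Z
    \<longleftrightarrow> complex_solution (poly2 f) (poly2 g) S (\<lambda>t. 1 / U t) (\<lambda>t. (e + k * U t + c * Z t) / U t)"
    (is "complex_solution ?F ?G S U Z \<longleftrightarrow> complex_solution _ _ S ?X ?Y")
proof -
  have F: "?F (U t) (Z t) = - (U t)\<^sup>2 * poly2 f (?X t) (?Y t)" if "t \<in> S" for t
  proof -
    have "U t ^ m = U t ^ (m - 1) * U t" using m(2) by (simp flip: power_Suc2)
    then show ?thesis
      using U0[OF that] m unfolding orig_time_def field_u_def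
      by (subst blowup_poly_eq) (auto simp: vf_degree_def power2_eq_square)
  qed
  have G: "?G (U t) (Z t) = ((- (e + k * U t + c * Z t) * poly2 f (?X t) (?Y t)
      + poly2 g (?X t) (?Y t)) * U t - k * ?F (U t) (Z t)) / c" if "t \<in> S" for t
  proof -
    have p: "U t ^ m = U t ^ (m - 1) * U t" using m(2) by (simp flip: power_Suc2)
    have "blowup_poly m f (U t) (e + k * U t + c * Z t) / U t ^ (m - 1) = U t * poly2 f (?X t) (?Y t)"
      "blowup_poly m g (U t) (e + k * U t + c * Z t) / U t ^ (m - 1) = U t * poly2 g (?X t) (?Y t)"
      using U0[OF that] m p by (auto simp: blowup_poly_eq vf_degree_def)
    note pf = this
    have split: "(- w * a + b - k * q) / c / v = (- w * (a / v) + b / v - k * (q / v)) / c"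
      for w a b q v :: complex
      by (simp add: add_divide_distrib diff_divide_distrib mult.commute)
    show ?thesis
      unfolding orig_time_def field_z_def Let_def split pf
      by (simp add: algebra_simps)
  qed
  show ?thesis
  proof
    assume L: "complex_solution ?F ?G S U Z"
    show "complex_solution (poly2 f) (poly2 g) S ?X ?Y"
      unfolding complex_solution_def
    proof (intro ballI conjI)
      fix t assume t: "t \<in> S"
      note d = L[unfolded complex_solution_def, rule_format, OF t]
      note U = U0[OF t]
      show "(?X has_field_derivative poly2 f (?X t) (?Y t)) (at t)"
        by (rule derivative_eq_intros refl conjunct1[OF d] U)+
           (use U F[OF t] in \<open>simp add: power2_eq_square\<close>)
      have dY: "(?Y has_field_derivative
          ((k * ?F (U t) (Z t) + c * ?G (U t) (Z t)) * U t - (e + k * U t + c * Z t) * ?F (U t) (Z t))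
          / (U t * U t)) (at t)"
        by (rule derivative_eq_intros refl conjunct1[OF d] conjunct2[OF d] U)+ simp
      have alg: "((k * p + c * (((- w * a + b) * v - k * p) / c)) * v - w * p) / (v * v) = b"
        if "v \<noteq> 0" "p = - v\<^sup>2 * a" for a b p v w
      proof -
        have "c * (((- w * a + b) * v - k * p) / c) = (- w * a + b) * v - k * p"
          using \<open>c \<noteq> 0\<close> by simp
        moreover have "(k * p + ((- w * a + b) * v - k * p)) * v - w * p = b * (v * v)"
          unfolding that(2) by (simp add: algebra_simps power2_eq_square)
        ultimately show ?thesis using that(1) by simp
      qed
      show "(?Y has_field_derivative poly2 g (?X t) (?Y t)) (at t)"
        using dY unfolding G[OF t] alg[OF U F[OF t]] .
    qed
  next
    assume R: "complex_solution (poly2 f) (poly2 g) S ?X ?Y"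
    show "complex_solution ?F ?G S U Z"
      unfolding complex_solution_def
    proof (intro ballI conjI)
      fix t assume t: "t \<in> S"
      note d = R[unfolded complex_solution_def, rule_format, OF t]
      note U = U0[OF t]
      have "((\<lambda>t. 1 / ?X t) has_field_derivative ?F (U t) (Z t)) (at t)"
        by (rule derivative_eq_intros refl conjunct1[OF d])+
           (use U F[OF t] in \<open>auto simp: power2_eq_square\<close>)
      then show dU: "(U has_field_derivative ?F (U t) (Z t)) (at t)" by simp
      have "((\<lambda>t. (?Y t * U t - e - k * U t) / c) has_field_derivative
          (poly2 g (?X t) (?Y t) * U t + ?F (U t) (Z t) * ?Y t - k * ?F (U t) (Z t)) / c) (at t)"
        by (rule derivative_eq_intros refl conjunct2[OF d] dU \<open>c \<noteq> 0\<close>)+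
           (use \<open>c \<noteq> 0\<close> in simp)
      note dZ = this
      have FY: "?F (U t) (Z t) * ?Y t = - (e + k * U t + c * Z t) * poly2 f (?X t) (?Y t) * U t"
        unfolding F[OF t] using U by (simp add: power2_eq_square) (simp add: algebra_simps)
      have comm: "(q * v + r * a * v - l) / c = ((r * a + q) * v - l) / c" for q v r a l
        by (simp add: algebra_simps)
      have "((\<lambda>t. (?Y t * U t - e - k * U t) / c) has_field_derivative
          ?G (U t) (Z t)) (at t)"
        using dZ unfolding FY G[OF t] comm .
      then show "(Z has_field_derivative ?G (U t) (Z t)) (at t)"
        by (rule has_field_derivative_transform_within_open[OF _ \<open>open S\<close> t])
           (use U0 \<open>c \<noteq> 0\<close> in auto)
    qed
  qed
qed

end

theory Submission
  imports Defs
begin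

text \<open>On the leaf \<open>z = 0\<close> the blow-up equation is \<open>du/dt\<^sub>1 = u \<phi>(u)\<close> with a polynomial \<open>\<phi>\<close> and
\<open>\<phi>(0) = \<lambda>\<^sub>1 \<noteq> 0\<close>. In original time this reads \<open>dt = u\<^bsup>m-2\<^esup> du / \<phi>(u)\<close>: along every solution on
the leaf, time is a holomorphic function of position, up to an additive constant. The primitive
\<open>\<Phi>\<close> of \<open>u\<^bsup>m-2\<^esup> / \<phi>(u)\<close> with \<open>\<Phi>(0) = 0\<close> is single-valued near \<open>u = 0\<close> and vanishes there to the
exact order \<open>m - 1\<close>, so that \<open>\<Phi>(u) = u\<^bsup>m-1\<^esup> exp(q(u))\<close> with \<open>q\<close> holomorphic
(\<open>primitive_with_zero_of_order\<close>).

Blow-up at time \<open>T\<close> means that \<open>u \<rightarrow> 0\<close> as \<open>t \<rightarrow> T\<close>, which fixes the additive constant: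
\<open>t = T + \<Phi>(u)\<close> (\<open>blowup_time_unique\<close>, \<open>blowup_loop_time\<close>). A loop \<open>\<gamma>u\<close> on the leaf therefore
determines its time loop, \<open>\<gamma>t = T + \<Phi> \<circ> \<gamma>u\<close>, which closes up because \<open>\<gamma>u\<close> does. Conversely
this curve does carry the solution \<open>\<gamma>u\<close>, since \<open>\<Phi>' \<noteq> 0\<close> off the origin makes \<open>u\<close> locally a
holomorphic function of \<open>t\<close> (\<open>time_imp_solution_along\<close>).

The factor \<open>exp \<circ> q \<circ> \<gamma>u\<close> has a closed logarithm and contributes nothing to the winding number, so
\<open>\<gamma>t\<close> winds \<open>m - 1\<close> times as often around \<open>T\<close> as \<open>\<gamma>u\<close> winds around \<open>0\<close>
(\<open>winding_number_time\<close>). For winding number \<open>1\<close> of \<open>\<gamma>u\<close> this gives \<open>m - 1\<close>; and since every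
blow-up loop arises in this way, all positive winding numbers of time loops are positive multiples
of \<open>m - 1\<close>, whence minimality.\<close>

section \<open>The leaf inside the polynomial system\<close>

lemma poly2_pCons: "poly2 (pCons a p) x y = poly a x + y * poly2 p x y"
  by (simp add: poly2_def)

lemma poly2_0 [simp]: "poly2 0 x y = 0"
  by (simp add: poly2_def)

lemma poly2_const [simp]: "poly2 [:a:] x y = poly a x"
  by (simp add: poly2_pCons)

lemma poly2_add: "poly2 (p + q) x y = poly2 p x y + poly2 q x y"
  by (simp add: poly2_def)

lemma poly2_smult: "poly2 (smult a p) x y = poly a x * poly2 p x y"
  by (simp add: poly2_def)

lemma holomorphic_on_poly2:
  assumes "U holomorphic_on S" "Z holomorphic_on S"
  shows "(\<lambda>t. poly2 p (U t) (Z t)) holomorphic_on S"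
proof (induction p)
  case (pCons a p)
  have "(\<lambda>t. poly a (U t)) holomorphic_on S"
    unfolding poly_altdef by (intro holomorphic_intros assms)
  then show ?case
    unfolding poly2_pCons by (intro holomorphic_intros assms pCons.IH)
qed simp

lemma trivial_leaf_imp_G_vanishes:
  assumes "trivial_leaf F G L" "u \<in> L"
  shows "G u 0 = 0"
proof -
  obtain r U Z where r: "r > 0" and sol: "complex_solution F G (ball 0 r) U Z"
    and U0: "U 0 = u" and Z0: "\<forall>t\<in>ball 0 r. U t \<in> L \<and> Z t = 0"
    using assms unfolding trivial_leaf_def by metis
  have "(Z has_field_derivative G u 0) (at 0)"
    using sol r U0 Z0 unfolding complex_solution_def by fastforce
  moreover have "(Z has_field_derivative 0) (at 0)"
    by (rule has_field_derivative_transform_within_open[where f = "\<lambda>_. 0" and S = "ball 0 r"])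
       (use r Z0 in auto)
  ultimately show ?thesis by (rule DERIV_unique)
qed

text \<open>The restriction of \<open>G\<close> to \<open>z = 0\<close> is a polynomial in \<open>u\<close> with infinitely many zeros, hence zero.
The factor \<open>z\<close> makes the equation for \<open>z\<close> along a given solution linear, which is what keeps
solutions that touch \<open>z = 0\<close> on it, whether or not \<open>u\<close> stays in \<open>L\<close>.\<close>

lemma trivial_leaf_imp_G_divisible:
  assumes form: "blowup_form F G l1 l2 c2" and leaf: "trivial_leaf F G L"
  obtains K where "\<And>u z. G u z = z * poly2 K u z"
proof -
  obtain Q R where G: "\<And>u z. G u z = z * (of_real l2 + poly2 Q u z) + u\<^sup>2 * (c2 + poly2 R u z)"
    using form unfolding blowup_form_def by blast
  \<comment> \<open>The coefficient \<open>r0\<close> collects the monomials of \<open>R\<close> that are free of \<open>z\<close>.\<close>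
  obtain r0 R1 where R: "R = pCons r0 R1" by (cases R)
  obtain D where D: "open D" "0 \<in> D" "L = D - {0}"
    using leaf unfolding trivial_leaf_def by blast
  have "infinite D" using D finite_imp_not_open[of D] by blast
  then have "infinite L" using D(3) by simp
  have "poly ([:c2:] + r0) u = 0" if "u \<in> L" for u
    using trivial_leaf_imp_G_vanishes[OF leaf that] that D(3) unfolding G R
    by (simp add: poly2_pCons)
  then have "L \<subseteq> {u. poly ([:c2:] + r0) u = 0}" by (intro subsetI CollectI)
  then have "infinite {u. poly ([:c2:] + r0) u = 0}"
    using \<open>infinite L\<close> by (rule infinite_super)
  then have "[:c2:] + r0 = 0" using poly_roots_finite by blast
  then have r0: "c2 + poly r0 u = 0" for u
    by (metis poly_0 poly_add poly_const_conv)
  define K where "K = [:[:of_real l2:]:] + Q + smult (monom 1 2) R1"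
  have "G u z = z * poly2 K u z" for u z
  proof -
    have "c2 + poly2 R u z = z * poly2 R1 u z"
      using r0[of u] unfolding R poly2_pCons by (simp flip: add.assoc)
    then show ?thesis
      unfolding G K_def by (simp add: poly2_add poly2_smult poly_monom algebra_simps)
  qed
  then show ?thesis by (rule that)
qed

text \<open>With the integrating factor \<open>exp(-\<integral>H)\<close>, the product \<open>Z exp(-\<integral>H)\<close> has derivative \<open>0\<close>.\<close>

lemma linear_ode_zero:
  fixes Z H :: "complex \<Rightarrow> complex"
  assumes S: "convex S" "open S" "t0 \<in> S" and H: "H holomorphic_on S"
    and Z': "\<And>t. t \<in> S \<Longrightarrow> (Z has_field_derivative Z t * H t) (at t)" and "Z t0 = 0"
    and "t \<in> S"
  shows "Z t = 0"
proof -
  obtain W where W: "\<And>t. t \<in> S \<Longrightarrow> (W has_field_derivative H t) (at t)"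
    using holomorphic_convex_primitive'[OF S(1,2) H] S(2) by (metis at_within_open)
  have "((\<lambda>t. Z t * exp (- W t)) has_field_derivative 0) (at t)" if "t \<in> S" for t
    by (rule derivative_eq_intros refl Z' W that)+ (simp add: algebra_simps)
  then have "(\<lambda>t. Z t * exp (- W t)) constant_on S"
    using S by (intro has_field_derivative_0_imp_constant_on convex_connected)
  then show ?thesis
    using assms unfolding constant_on_def by (metis exp_not_eq_zero mult_eq_0_iff)
qed

section \<open>Primitives with a zero of prescribed order\<close>

text \<open>Uniqueness of the order of a zero: if \<open>a < b\<close>, division by \<open>u\<^sup>a\<close> and \<open>u \<rightarrow> 0\<close> give \<open>f(0) = 0\<close>.\<close>

lemma zero_order_le:
  fixes f g :: "complex \<Rightarrow> complex"
  assumes "r > 0" and eq: "\<And>u. u \<in> ball 0 r \<Longrightarrow> u ^ a * f u = u ^ b * g u"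
    and "isCont f 0" "isCont g 0" "f 0 \<noteq> 0"
  shows "b \<le> a"
proof (rule ccontr)
  assume "\<not> b \<le> a"
  have "((\<lambda>u. u ^ (b - a) * g u) \<longlongrightarrow> 0 ^ (b - a) * g 0) (at 0)"
    by (intro tendsto_intros) (use assms(4) in \<open>simp add: isCont_def\<close>)
  then have "((\<lambda>u. u ^ (b - a) * g u) \<longlongrightarrow> 0) (at 0)"
    using \<open>\<not> b \<le> a\<close> by (simp add: power_0_left)
  moreover have "u ^ (b - a) * g u = f u" if "u \<in> ball 0 r" "u \<noteq> 0" for u
  proof -
    have "u ^ a * (u ^ (b - a) * g u) = u ^ a * f u"
      using \<open>\<not> b \<le> a\<close> eq[OF that(1)] by (simp flip: mult.assoc power_add)
    then show ?thesis using that(2) by simp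
  qed
  ultimately have "(f \<longlongrightarrow> 0) (at 0)"
    using Lim_transform_within_open[of "\<lambda>u. u ^ (b - a) * g u" 0 0 UNIV "ball 0 r" f] \<open>r > 0\<close> by auto
  with assms(3,5) show False
    using LIM_unique unfolding isCont_def by blast
qed

text \<open>A nonconstant primitive that vanishes at \<open>0\<close> equals \<open>u\<^sup>n g(u)\<close> with \<open>g(0) \<noteq> 0\<close>. Its derivative
\<open>u\<^bsup>n-1\<^esup> (n g + u g')\<close> has order \<open>n - 1\<close>, and comparing orders gives \<open>n = k + 1\<close>. On a disc the
zero-free function \<open>g\<close> has a holomorphic logarithm.\<close>

lemma primitive_with_zero_of_order:
  fixes \<psi> :: "complex \<Rightarrow> complex"
  assumes "r > 0" and hol: "\<psi> holomorphic_on ball 0 r" and "\<psi> 0 \<noteq> 0"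
  obtains \<epsilon> \<Phi> q where "\<epsilon> > 0" "\<epsilon> \<le> r" "q holomorphic_on ball 0 \<epsilon>"
    "\<And>u. u \<in> ball 0 \<epsilon> \<Longrightarrow> (\<Phi> has_field_derivative u ^ k * \<psi> u) (at u)"
    "\<And>u. u \<in> ball 0 \<epsilon> \<Longrightarrow> \<Phi> u = u ^ Suc k * exp (q u)"
proof -
  have "(\<lambda>u. u ^ k * \<psi> u) holomorphic_on ball 0 r" by (intro holomorphic_intros hol)
  from holomorphic_convex_primitive'[OF convex_ball open_ball this] obtain \<Phi>0
    where \<Phi>0: "\<And>u. u \<in> ball 0 r \<Longrightarrow>
      (\<Phi>0 has_field_derivative u ^ k * \<psi> u) (at u within ball 0 r)"
    by blast
  have \<Phi>: "((\<lambda>u. \<Phi>0 u - \<Phi>0 0) has_field_derivative u ^ k * \<psi> u) (at u)" if "u \<in> ball 0 r" for u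
    using DERIV_diff[OF \<Phi>0[OF that, unfolded at_within_open[OF that open_ball]] DERIV_const] by simp
  define \<Phi> where "\<Phi> u = \<Phi>0 u - \<Phi>0 0" for u
  note \<Phi>' = \<Phi>[folded \<Phi>_def]
  have hol\<Phi>: "\<Phi> holomorphic_on ball 0 r"
    using \<Phi>' by (meson field_differentiable_at_within field_differentiable_def holomorphic_on_def)
  have cont\<psi>: "isCont \<psi> 0"
    using holomorphic_on_imp_continuous_on[OF hol] \<open>r > 0\<close>
    by (simp add: continuous_on_eq_continuous_at)
  have nonconst: "\<not> \<Phi> constant_on ball 0 r"
  proof
    assume "\<Phi> constant_on ball 0 r"
    then obtain c where c: "\<And>u. u \<in> ball 0 r \<Longrightarrow> \<Phi> u = c" unfolding constant_on_def by blast
    have "u ^ k * \<psi> u = u ^ Suc k * 0" if "u \<in> ball 0 r" for u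
    proof -
      have "(\<Phi> has_field_derivative 0) (at u)"
        by (rule has_field_derivative_transform_within_open[where f = "\<lambda>_. c" and S = "ball 0 r"])
           (use c that in auto)
      then show ?thesis using \<Phi>'[OF that] DERIV_unique by fastforce
    qed
    then have "Suc k \<le> k"
      using zero_order_le[of r k \<psi> "Suc k" "\<lambda>_. 0"] cont\<psi> assms by auto
    then show False by simp
  qed
  have "0 \<in> ball 0 r" "\<Phi> 0 = 0" using \<open>r > 0\<close> by (auto simp: \<Phi>_def)
  obtain g s n where n: "0 < n" and s: "0 < s" "ball (0::complex) s \<subseteq> ball 0 r"
    and g: "g holomorphic_on ball 0 s" "\<And>u. u \<in> ball 0 s \<Longrightarrow> \<Phi> u = (u - 0) ^ n * g u"
      "\<And>u. u \<in> ball 0 s \<Longrightarrow> g u \<noteq> 0"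
    by (rule holomorphic_factor_zero_nonconstant[OF hol\<Phi> open_ball connected_ball
          \<open>0 \<in> ball 0 r\<close> \<open>\<Phi> 0 = 0\<close> nonconst]) (rule that)
  define g2 where "g2 u = of_nat n * g u + u * deriv g u" for u
  have eq: "u ^ k * \<psi> u = u ^ (n - 1) * g2 u" if "u \<in> ball 0 s" for u
  proof -
    have "((\<lambda>u. u ^ n * g u) has_field_derivative u ^ (n - 1) * g2 u) (at u)"
      by (rule derivative_eq_intros refl holomorphic_derivI[OF g(1) open_ball that])+
         (use n in \<open>simp add: g2_def algebra_simps flip: power_Suc2 power_Suc\<close>)
    then have "(\<Phi> has_field_derivative u ^ (n - 1) * g2 u) (at u)"
      by (rule has_field_derivative_transform_within_open[where S = "ball 0 s"])
         (use that g(2) in auto)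
    then show ?thesis using \<Phi>' that s(2) DERIV_unique by blast
  qed
  have "g2 holomorphic_on ball 0 s"
    unfolding g2_def by (intro holomorphic_intros g(1)) auto
  then have "continuous_on (ball 0 s) g2" by (rule holomorphic_on_imp_continuous_on)
  then have "isCont g2 0"
    using s(1) by (simp add: continuous_on_eq_continuous_at)
  moreover have "g2 0 \<noteq> 0" using g(3)[of 0] s(1) n by (simp add: g2_def)
  ultimately have "k = n - 1"
    using zero_order_le[OF s(1) eq cont\<psi>] zero_order_le[OF s(1) eq[symmetric]] cont\<psi> assms(3)
    by (intro antisym) auto
  then have n': "n = Suc k" using n by simp
  obtain q where q: "q holomorphic_on ball 0 s" "\<And>u. u \<in> ball 0 s \<Longrightarrow> exp (q u) = g u"
    using holomorphic_logarithm_exists[OF convex_ball open_ball g(1,3), of 0] s(1) by auto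
  have "s \<le> r" using s by (simp add: ball_subset_ball_iff)
  show ?thesis
    by (rule that[OF s(1) \<open>s \<le> r\<close> q(1), of \<Phi>]) (use \<Phi>' s(2) g(2) q(2) n' in auto)
qed

section \<open>Winding numbers\<close>

text \<open>If \<open>exp \<circ> l = \<gamma>\<close> for a continuous \<open>l\<close>, then \<open>n l + q \<circ> \<gamma>\<close> is a continuous logarithm of
\<open>\<gamma>\<^sup>n exp(q \<circ> \<gamma>)\<close>. Its second summand is a closed curve, so only \<open>n l\<close> contributes to the increment.\<close>

lemma winding_number_power_times_exp:
  fixes \<gamma> :: "real \<Rightarrow> complex"
  assumes "path \<gamma>" "pathfinish \<gamma> = pathstart \<gamma>" "0 \<notin> path_image \<gamma>"
    and "path_image \<gamma> \<subseteq> S" "continuous_on S q"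
  shows "winding_number (\<lambda>s. T + \<gamma> s ^ n * exp (q (\<gamma> s))) T = of_nat n * winding_number \<gamma> 0"
proof -
  obtain l where l: "path l" "pathfinish l - pathstart l = 2 * of_real pi * \<i> * winding_number \<gamma> 0"
    "\<And>s. s \<in> {0..1} \<Longrightarrow> \<gamma> s = 0 + exp (l s)"
    using winding_number_as_continuous_log[OF assms(1,3)] by blast
  define p where "p = (\<lambda>s. of_nat n * l s + q (\<gamma> s))"
  have "continuous_on {0..1} (\<lambda>s. q (\<gamma> s))"
    by (rule continuous_on_compose2[OF assms(5)]) (use assms in \<open>auto simp: path_def path_image_def\<close>)
  then have "path p"
    using l(1) unfolding path_def p_def by (intro continuous_intros)
  have "winding_number (\<lambda>s. T + \<gamma> s ^ n * exp (q (\<gamma> s))) T = winding_number (exp \<circ> p) 0"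
    unfolding winding_number_offset[of _ T]
    by (rule winding_number_cong) (simp add: l(3) p_def exp_add exp_of_nat_mult)
  also have "\<dots> = (pathfinish p - pathstart p) / (2 * of_real pi * \<i>)"
    by (rule winding_number_compose_exp) fact
  also have "pathfinish p - pathstart p = of_nat n * (pathfinish l - pathstart l)"
    using assms(2) by (simp add: p_def pathfinish_def pathstart_def algebra_simps)
  also have "of_nat n * (pathfinish l - pathstart l) / (2 * of_real pi * \<i>) = of_nat n * winding_number \<gamma> 0"
    unfolding l(2) by (simp add: field_simps del: divide_i)
  finally show ?thesis .
qed

section \<open>Time as a function on the leaf\<close>

text \<open>\<open>\<Phi> u\<close> is the time elapsed since blow-up for the solution at position \<open>u\<close> on the leaf; \<open>\<epsilon>\<close> is small
enough that neither the vector field nor \<open>\<Phi>\<close> has a zero other than \<open>0\<close> in the disc.\<close>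

locale leaf_time =
  fixes m :: nat and F G :: "complex \<Rightarrow> complex \<Rightarrow> complex" and K :: "complex poly poly"
    and \<phi> \<Phi> q :: "complex \<Rightarrow> complex" and \<epsilon> :: real
  assumes m_ge_2: "m \<ge> 2" and \<epsilon>_pos: "\<epsilon> > 0"
    and F_leaf: "F u 0 = u * \<phi> u"
    and G_divisible: "G u z = z * poly2 K u z"
    and \<phi>_nz: "u \<in> ball 0 \<epsilon> \<Longrightarrow> \<phi> u \<noteq> 0"
    and \<Phi>_deriv: "u \<in> ball 0 \<epsilon> \<Longrightarrow> (\<Phi> has_field_derivative u ^ (m - 2) / \<phi> u) (at u)"
    and \<Phi>_eq: "u \<in> ball 0 \<epsilon> \<Longrightarrow> \<Phi> u = u ^ (m - 1) * exp (q u)"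
    and q_holo: "q holomorphic_on ball 0 \<epsilon>"
begin

lemma \<Phi>_0: "\<Phi> 0 = 0"
  using \<Phi>_eq[of 0] \<epsilon>_pos m_ge_2 by (simp add: power_0_left)

lemma \<Phi>_nz: "u \<in> ball 0 \<epsilon> - {0} \<Longrightarrow> \<Phi> u \<noteq> 0"
  using \<Phi>_eq[of u] by simp

lemma \<Phi>_holo: "\<Phi> holomorphic_on ball 0 \<epsilon>"
  using \<Phi>_deriv by (meson field_differentiable_at_within field_differentiable_def holomorphic_on_def)

lemma \<Phi>_cont: "continuous_on (ball 0 \<epsilon>) \<Phi>"
  by (rule holomorphic_on_imp_continuous_on[OF \<Phi>_holo])

text \<open>The speed in original time is the reciprocal of \<open>\<Phi>'\<close>.\<close>

lemma orig_time_leaf: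
  assumes "u \<in> ball 0 \<epsilon> - {0}"
  shows "orig_time m F u 0 = inverse (u ^ (m - 2) / \<phi> u)"
proof -
  have "m - 1 = Suc (m - 2)" using m_ge_2 by simp
  then show ?thesis using assms by (simp add: orig_time_def F_leaf)
qed

text \<open>A solution germ along a curve on the leaf has \<open>Z = 0\<close> only on that curve to begin with. As \<open>G\<close> is
divisible by \<open>z\<close>, the equation for \<open>Z\<close> is linear with \<open>Z\<close> as a factor, so \<open>Z\<close> vanishes on the whole
disc and \<open>U\<close> solves the scalar equation of the leaf.\<close>

lemma solution_stays_on_leaf:
  assumes sol: "complex_solution (orig_time m F) (orig_time m G) (ball t0 r) U Z"
    and U: "\<And>t. t \<in> ball t0 r \<Longrightarrow> U t \<noteq> 0" and "Z t0 = 0" "t \<in> ball t0 r"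
  shows "Z t = 0"
proof -
  have "U holomorphic_on ball t0 r" "Z holomorphic_on ball t0 r"
    using sol unfolding complex_solution_def
    by (meson field_differentiable_at_within field_differentiable_def holomorphic_on_def)+
  then have H: "(\<lambda>t. poly2 K (U t) (Z t) / U t ^ (m - 1)) holomorphic_on ball t0 r"
    by (intro holomorphic_intros holomorphic_on_poly2) (use U in auto)
  have Z': "(Z has_field_derivative Z t * (poly2 K (U t) (Z t) / U t ^ (m - 1))) (at t)"
    if "t \<in> ball t0 r" for t
    using sol that unfolding complex_solution_def orig_time_def G_divisible by simp
  have "r > 0" using assms(4) by (metis ball_eq_empty empty_iff not_le)
  then have "t0 \<in> ball t0 r" by simp
  then show ?thesis
    by (rule linear_ode_zero[OF convex_ball open_ball _ H Z' assms(3,4)])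
qed

text \<open>Separation of variables: by the chain rule \<open>t - \<Phi>(U(t))\<close> has derivative \<open>0\<close> for each germ \<open>U\<close>, so
\<open>\<gamma> - \<Phi> \<circ> a\<close> is locally constant on the connected parameter set.\<close>

lemma solution_along_imp_time:
  assumes I: "connected I" and \<gamma>: "continuous_on I \<gamma>"
    and a: "a ` I \<subseteq> ball 0 \<epsilon>"
    and sol: "solution_along m F G I \<gamma> a (\<lambda>_. 0)"
  shows "continuous_on I a" and "(\<lambda>s. \<gamma> s - \<Phi> (a s)) constant_on I"
proof -
  have germ: "\<exists>V. openin (top_of_set I) V \<and> s \<in> V \<and> continuous (at s within I) a \<and>
      (\<forall>s'\<in>V. \<gamma> s' - \<Phi> (a s') = \<gamma> s - \<Phi> (a s))" if s: "s \<in> I" for s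
  proof -
    obtain r \<delta> U Z where r: "r > 0" and \<delta>: "\<delta> > 0"
      and UZ: "complex_solution (orig_time m F) (orig_time m G) (ball (\<gamma> s) r) U Z"
      and U0: "\<And>t. t \<in> ball (\<gamma> s) r \<Longrightarrow> U t \<noteq> 0"
      and near: "\<And>s'. s' \<in> I \<Longrightarrow> \<bar>s' - s\<bar> < \<delta> \<Longrightarrow> \<gamma> s' \<in> ball (\<gamma> s) r \<and> a s' = U (\<gamma> s') \<and> 0 = Z (\<gamma> s')"
      using bspec[OF sol[unfolded solution_along_def] s] by blast
    have here: "a s = U (\<gamma> s)" "Z (\<gamma> s) = 0" using near[OF s] \<delta> by auto
    have Z0: "Z t = 0" if "t \<in> ball (\<gamma> s) r" for t
      using solution_stays_on_leaf[OF UZ U0 here(2) that] .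
    have U': "(U has_field_derivative orig_time m F (U t) 0) (at t)" if "t \<in> ball (\<gamma> s) r" for t
      using UZ Z0[OF that] that unfolding complex_solution_def by metis
    have contU: "continuous_on (ball (\<gamma> s) r) U"
      using U' DERIV_isCont by (metis continuous_at_imp_continuous_on)
    \<comment> \<open>The germ may leave the disc on which \<open>\<Phi>\<close> is a primitive; a smaller time disc avoids this.\<close>
    have "\<exists>d>0. ball (\<gamma> s) d \<subseteq> ball (\<gamma> s) r \<inter> U -` ball 0 \<epsilon>"
    proof -
      have "open (ball (\<gamma> s) r \<inter> U -` ball 0 \<epsilon>)"
        by (rule continuous_open_preimage[OF contU]) auto
      moreover have "\<gamma> s \<in> ball (\<gamma> s) r \<inter> U -` ball 0 \<epsilon>"
        using r here(1) a s by (auto simp: image_subset_iff)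
      ultimately show ?thesis using open_contains_ball by blast
    qed
    then obtain d where d: "d > 0" "ball (\<gamma> s) d \<subseteq> ball (\<gamma> s) r" "\<And>t. t \<in> ball (\<gamma> s) d \<Longrightarrow> U t \<in> ball 0 \<epsilon>"
      by blast
    have "((\<lambda>t. t - \<Phi> (U t)) has_field_derivative 0) (at t)" if t: "t \<in> ball (\<gamma> s) d" for t
    proof -
      have u: "U t \<in> ball 0 \<epsilon> - {0}" using d t U0 by blast
      have "((\<lambda>t. \<Phi> (U t)) has_field_derivative
          (U t ^ (m - 2) / \<phi> (U t)) * orig_time m F (U t) 0) (at t)"
        by (rule DERIV_chain2[OF \<Phi>_deriv U']) (use d t in auto)
      also have "(U t ^ (m - 2) / \<phi> (U t)) * orig_time m F (U t) 0 = 1"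
        using u \<phi>_nz[of "U t"] by (simp add: orig_time_leaf)
      finally have "((\<lambda>t. \<Phi> (U t)) has_field_derivative 1) (at t)" .
      then show ?thesis by (auto intro!: derivative_eq_intros)
    qed
    then have "(\<lambda>t. t - \<Phi> (U t)) constant_on ball (\<gamma> s) d"
      by (intro has_field_derivative_0_imp_constant_on) auto
    then have const: "t - \<Phi> (U t) = \<gamma> s - \<Phi> (U (\<gamma> s))" if "t \<in> ball (\<gamma> s) d" for t
      using that d(1) unfolding constant_on_def by (metis centre_in_ball)
    let ?V = "(I \<inter> \<gamma> -` ball (\<gamma> s) d) \<inter> ball s \<delta>"
    have "openin (top_of_set I) (I \<inter> \<gamma> -` ball (\<gamma> s) d)"
      by (rule continuous_openin_preimage_gen[OF \<gamma>]) auto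
    then have "openin (top_of_set I) ?V"
      by (metis openin_Int_open open_ball)
    moreover have "s \<in> ?V" using s d(1) \<delta> by auto
    moreover have a_eq: "a s' = U (\<gamma> s')" if "s' \<in> ?V" for s'
      using near[of s'] that by (auto simp: dist_real_def abs_minus_commute)
    moreover have "continuous (at s within I) a"
    proof (rule continuous_transform_within[OF _ \<delta> s])
      have "isCont U (\<gamma> s)" using DERIV_isCont[OF U'[of "\<gamma> s"]] r by simp
      moreover have "continuous (at s within I) \<gamma>" using \<gamma> s by (simp add: continuous_on_eq_continuous_within)
      ultimately show "continuous (at s within I) (\<lambda>s'. U (\<gamma> s'))"
        by (rule continuous_within_compose3)
    qed (metis near dist_real_def)
    moreover have "\<forall>s'\<in>?V. \<gamma> s' - \<Phi> (a s') = \<gamma> s - \<Phi> (a s)"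
      using const a_eq here(1) by auto
    ultimately show ?thesis by blast
  qed
  show "(\<lambda>s. \<gamma> s - \<Phi> (a s)) constant_on I"
    by (rule locally_constant_imp_constant[OF I]) (use germ in blast)
  show "continuous_on I a"
    using germ by (auto simp: continuous_on_eq_continuous_within)
qed

text \<open>The required germ at parameter \<open>s\<close> is the local inverse of \<open>T + \<Phi>\<close> near \<open>\<mu> s\<close>; it exists because
\<open>\<Phi>'\<close> has no zero off the origin.\<close>

lemma time_imp_solution_along:
  assumes \<mu>: "continuous_on I \<mu>" "\<mu> ` I \<subseteq> ball 0 \<epsilon> - {0}"
  shows "solution_along m F G I (\<lambda>s. T + \<Phi> (\<mu> s)) \<mu> (\<lambda>_. 0)"
  unfolding solution_along_def
proof
  fix s assume s: "s \<in> I"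
  define B where "B = ball (0::complex) \<epsilon> - {0}"
  have B: "open B" "\<mu> s \<in> B" using \<mu> s by (auto simp: B_def)
  have \<Phi>': "((\<lambda>u. T + \<Phi> u) has_field_derivative u ^ (m - 2) / \<phi> u) (at u)" if "u \<in> B" for u
    using \<Phi>_deriv[of u] that by (auto simp: B_def intro!: derivative_eq_intros)
  have hol: "(\<lambda>u. T + \<Phi> u) holomorphic_on B"
    by (intro holomorphic_intros holomorphic_on_subset[OF \<Phi>_holo]) (auto simp: B_def)
  have nz: "u ^ (m - 2) / \<phi> u \<noteq> 0" if "u \<in> B" for u
    using that \<phi>_nz by (auto simp: B_def)
  obtain d where d: "d > 0" "ball (\<mu> s) d \<subseteq> B" and inj: "inj_on (\<lambda>u. T + \<Phi> u) (ball (\<mu> s) d)"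
    using has_complex_derivative_locally_injective[OF hol B(2,1)] DERIV_imp_deriv[OF \<Phi>'] nz B(2)
    by (metis (no_types, lifting))
  define N where "N = ball (\<mu> s) d"
  have holN: "(\<lambda>u. T + \<Phi> u) holomorphic_on N"
    using hol d(2) holomorphic_on_subset unfolding N_def by blast
  obtain U where U: "U holomorphic_on (\<lambda>u. T + \<Phi> u) ` N"
    "\<And>u. u \<in> N \<Longrightarrow> deriv (\<lambda>u. T + \<Phi> u) u * deriv U (T + \<Phi> u) = 1"
    "\<And>u. u \<in> N \<Longrightarrow> U (T + \<Phi> u) = u"
    using holomorphic_has_inverse[OF holN _ inj[folded N_def]] unfolding N_def by auto
  have opN: "open ((\<lambda>u. T + \<Phi> u) ` N)"
    by (rule open_mapping_thm3[OF holN _ inj[folded N_def]]) (simp add: N_def)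
  have "\<mu> s \<in> N" using d(1) by (simp add: N_def)
  then obtain r where r: "r > 0" "ball (T + \<Phi> (\<mu> s)) r \<subseteq> (\<lambda>u. T + \<Phi> u) ` N"
    using opN open_contains_ball by (metis (no_types, lifting) imageI)
  have sol: "complex_solution (orig_time m F) (orig_time m G) ((\<lambda>u. T + \<Phi> u) ` N) U (\<lambda>_. 0)"
    unfolding complex_solution_def
  proof (intro ballI conjI)
    fix t assume "t \<in> (\<lambda>u. T + \<Phi> u) ` N"
    then obtain u where u: "u \<in> N" "t = T + \<Phi> u" by blast
    have "u \<in> B" using u(1) d(2) by (auto simp: N_def)
    have "deriv U t = inverse (u ^ (m - 2) / \<phi> u)"
      using U(2)[OF u(1)] DERIV_imp_deriv[OF \<Phi>'[OF \<open>u \<in> B\<close>]] u(2) inverse_unique by metis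
    then have "deriv U t = orig_time m F (U t) 0"
      using orig_time_leaf[of u] \<open>u \<in> B\<close> U(3)[OF u(1)] u(2) by (simp add: B_def)
    then show "(U has_field_derivative orig_time m F (U t) 0) (at t)"
      using holomorphic_derivI[OF U(1) opN] u by (metis imageI)
    show "((\<lambda>_. 0) has_field_derivative orig_time m G (U t) 0) (at t)"
      by (simp add: orig_time_def G_divisible)
  qed
  have U_nz: "U t \<noteq> 0" if "t \<in> (\<lambda>u. T + \<Phi> u) ` N" for t
    using that U(3) d(2) by (auto simp: N_def B_def)
  obtain \<delta> where \<delta>: "\<delta> > 0" "\<And>s'. s' \<in> I \<Longrightarrow> \<bar>s' - s\<bar> < \<delta> \<Longrightarrow>
      T + \<Phi> (\<mu> s') \<in> ball (T + \<Phi> (\<mu> s)) r \<and> \<mu> s' \<in> N"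
  proof -
    have "continuous_on I (\<lambda>s. T + \<Phi> (\<mu> s))"
      by (intro continuous_intros continuous_on_compose2[OF \<Phi>_cont \<mu>(1)]) (use \<mu>(2) in auto)
    then obtain \<delta>1 where \<delta>1: "\<delta>1 > 0"
      "\<And>s'. s' \<in> I \<Longrightarrow> dist s' s < \<delta>1 \<Longrightarrow> dist (T + \<Phi> (\<mu> s')) (T + \<Phi> (\<mu> s)) < r"
      using s r(1) unfolding continuous_on_iff by blast
    obtain \<delta>2 where \<delta>2: "\<delta>2 > 0" "\<And>s'. s' \<in> I \<Longrightarrow> dist s' s < \<delta>2 \<Longrightarrow> dist (\<mu> s') (\<mu> s) < d"
      using \<mu>(1) s d(1) unfolding continuous_on_iff by blast
    show ?thesis
      by (rule that[of "min \<delta>1 \<delta>2"]) (use \<delta>1 \<delta>2 in \<open>auto simp: N_def dist_real_def dist_commute\<close>)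
  qed
  show "\<exists>r>0. \<exists>\<delta>>0. \<exists>U Z.
      complex_solution (orig_time m F) (orig_time m G) (ball (T + \<Phi> (\<mu> s)) r) U Z \<and>
      (\<forall>t\<in>ball (T + \<Phi> (\<mu> s)) r. U t \<noteq> 0) \<and>
      (\<forall>s'\<in>I. \<bar>s' - s\<bar> < \<delta> \<longrightarrow>
         T + \<Phi> (\<mu> s') \<in> ball (T + \<Phi> (\<mu> s)) r \<and> \<mu> s' = U (T + \<Phi> (\<mu> s')) \<and> 0 = Z (T + \<Phi> (\<mu> s')))"
  proof (rule exI[of _ r], rule conjI[OF r(1)], rule exI[of _ \<delta>], rule conjI,
      goal_cases _ germ)
    case germ
    have "complex_solution (orig_time m F) (orig_time m G) (ball (T + \<Phi> (\<mu> s)) r) U (\<lambda>_. 0)"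
      using sol r(2) unfolding complex_solution_def by blast
    moreover have "\<forall>t\<in>ball (T + \<Phi> (\<mu> s)) r. U t \<noteq> 0" using U_nz r(2) by blast
    ultimately show ?case
      using \<delta>(2) U(3)
      by - (rule exI[of _ U], rule exI[of _ "\<lambda>_. 0"], auto)
  qed (rule \<delta>(1))
qed

text \<open>An arc in \<open>D\<close> that ends at \<open>0\<close> meets \<open>0\<close> only at its end, by injectivity; lifting it by \<open>T + \<Phi>\<close> gives
a time path that ends at \<open>T + \<Phi>(0) = T\<close>.\<close>

lemma blows_up_at_time:
  assumes D: "open D" "connected D" "0 \<in> D" "D \<subseteq> ball 0 \<epsilon>" and u0: "u0 \<in> D - {0}"
  shows "blows_up_at m F G (D - {0}) T (T + \<Phi> u0) u0"
proof -
  have "path_connected D" using D connected_open_path_connected by blast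
  then obtain \<mu> where \<mu>: "arc \<mu>" "path_image \<mu> \<subseteq> D" "pathstart \<mu> = u0" "pathfinish \<mu> = 0"
    using u0 D(3) unfolding path_connected_arcwise by (metis DiffE singletonI)
  have cont: "continuous_on {0..1} \<mu>" using \<mu>(1) by (simp add: arc_def path_def)
  have \<mu>D: "\<mu> s \<in> D" if "s \<in> {0..1}" for s
    using \<mu>(2) that by (auto simp: path_image_def)
  have "\<mu> s \<noteq> 0" if "s \<in> {0..<1}" for s
    using \<mu>(1,4) that inj_onD[of \<mu> "{0..1}" s 1] by (auto simp: arc_def pathfinish_def)
  then have \<mu>L: "\<mu> ` {0..<1} \<subseteq> D - {0}" using \<mu>D by auto
  show ?thesis
    unfolding blows_up_at_def
  proof (rule exI[of _ "\<lambda>s. T + \<Phi> (\<mu> s)"], rule exI[of _ \<mu>], intro conjI)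
    show "path (\<lambda>s. T + \<Phi> (\<mu> s))"
      unfolding path_def
      by (intro continuous_intros continuous_on_compose2[OF \<Phi>_cont cont]) (use \<mu>D D(4) in auto)
    show "solution_along m F G {0..<1} (\<lambda>s. T + \<Phi> (\<mu> s)) \<mu> (\<lambda>_. 0)"
    proof (rule time_imp_solution_along)
      show "continuous_on {0..<1} \<mu>" by (rule continuous_on_subset[OF cont]) auto
      show "\<mu> ` {0..<1} \<subseteq> ball 0 \<epsilon> - {0}" using \<mu>L D(4) by blast
    qed
    have "(\<mu> \<longlongrightarrow> \<mu> 1) (at 1 within {0..1})"
      using cont by (simp add: continuous_on_def)
    then show "(\<mu> \<longlongrightarrow> 0) (at_left 1)"
      using \<mu>(4) by (simp add: pathfinish_def at_within_Icc_at_left)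
  qed (use \<mu> \<mu>L \<Phi>_0 in \<open>auto simp: pathstart_def pathfinish_def\<close>)
qed

text \<open>Along the path on which \<open>u \<rightarrow> 0\<close>, the constant \<open>\<eta> - \<Phi> \<circ> \<mu>\<close> equals its limit \<open>T - \<Phi>(0) = T\<close>.\<close>

lemma blowup_time_unique:
  assumes blow: "blows_up_at m F G L T t0 u0" and L: "L \<subseteq> ball 0 \<epsilon>"
  shows "t0 = T + \<Phi> u0"
proof -
  obtain \<eta> \<mu> where \<eta>: "path \<eta>" "pathstart \<eta> = t0" "pathfinish \<eta> = T"
    and \<mu>: "\<mu> 0 = u0" "\<mu> ` {0..<1} \<subseteq> L" and lim: "(\<mu> \<longlongrightarrow> 0) (at_left 1)"
    and sol: "solution_along m F G {0..<1} \<eta> \<mu> (\<lambda>_. 0)"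
    using blow unfolding blows_up_at_def by blast
  have cont: "continuous_on {0..1} \<eta>" using \<eta>(1) by (simp add: path_def)
  have "(\<lambda>s. \<eta> s - \<Phi> (\<mu> s)) constant_on {0..<1}"
  proof (rule solution_along_imp_time(2)[OF _ _ _ sol])
    show "continuous_on {0..<1} \<eta>" by (rule continuous_on_subset[OF cont]) auto
    show "\<mu> ` {0..<1} \<subseteq> ball 0 \<epsilon>" using \<mu>(2) L by blast
  qed simp
  then have const: "\<eta> s - \<Phi> (\<mu> s) = t0 - \<Phi> u0" if "s \<in> {0..<1}" for s
    using that \<eta>(2) \<mu>(1) unfolding constant_on_def pathstart_def
    by (metis atLeastLessThan_iff order_refl zero_less_one)
  have "(\<eta> \<longlongrightarrow> T) (at_left 1)"
    using cont \<eta>(3) by (auto simp: continuous_on_def pathfinish_def at_within_Icc_at_left dest!: bspec[of _ _ 1])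
  moreover have "((\<lambda>s. \<Phi> (\<mu> s)) \<longlongrightarrow> \<Phi> 0) (at_left 1)"
    using lim DERIV_isCont[OF \<Phi>_deriv[of 0]] \<epsilon>_pos isCont_tendsto_compose by fastforce
  ultimately have "((\<lambda>s. \<eta> s - \<Phi> (\<mu> s)) \<longlongrightarrow> T - \<Phi> 0) (at_left 1)"
    by (rule tendsto_diff)
  moreover have "\<forall>\<^sub>F s in at_left 1. \<eta> s - \<Phi> (\<mu> s) = t0 - \<Phi> u0"
    using eventually_at_left_real[OF zero_less_one] by eventually_elim (use const in auto)
  ultimately have "((\<lambda>s. t0 - \<Phi> u0) \<longlongrightarrow> T - \<Phi> 0) (at_left (1::real))"
    by (rule Lim_transform_eventually)
  then have "t0 - \<Phi> u0 = T - \<Phi> 0"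
    by (simp add: tendsto_const_iff)
  then show ?thesis using \<Phi>_0 by (simp add: algebra_simps)
qed

lemma winding_number_time:
  assumes "path \<gamma>" "pathfinish \<gamma> = pathstart \<gamma>" "path_image \<gamma> \<subseteq> ball 0 \<epsilon> - {0}"
  shows "winding_number (\<lambda>s. T + \<Phi> (\<gamma> s)) T = of_nat (m - 1) * winding_number \<gamma> 0"
proof -
  have "winding_number (\<lambda>s. T + \<Phi> (\<gamma> s)) T
      = winding_number (\<lambda>s. T + \<gamma> s ^ (m - 1) * exp (q (\<gamma> s))) T"
    by (rule winding_number_cong) (use assms(3) in \<open>auto simp: path_image_def \<Phi>_eq image_subset_iff\<close>)
  also have "\<dots> = of_nat (m - 1) * winding_number \<gamma> 0"
    by (rule winding_number_power_times_exp[where S = "ball 0 \<epsilon>"])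
       (use assms holomorphic_on_imp_continuous_on[OF q_holo] in auto)
  finally show ?thesis .
qed

text \<open>Every blow-up loop is the lift of its \<open>u\<close>-component by \<open>T + \<Phi>\<close>. In particular its time loop is unique,
and its winding number is a multiple of \<open>m - 1\<close>.\<close>

lemma blowup_loop_time:
  assumes loop: "blowup_loop m F G L T \<gamma>t \<gamma>u" and L: "L \<subseteq> ball 0 \<epsilon> - {0}"
  shows "path \<gamma>u" and "\<And>s. s \<in> {0..1} \<Longrightarrow> \<gamma>t s = T + \<Phi> (\<gamma>u s)"
    and "winding_number \<gamma>t T = of_nat (m - 1) * winding_number \<gamma>u 0"
proof -
  note l = loop[unfolded blowup_loop_def]
  have cont: "continuous_on {0..1} \<gamma>t" using l by (simp add: path_def)
  have img: "\<gamma>u ` {0..1} \<subseteq> ball 0 \<epsilon>" using l L by (auto simp: path_image_def)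
  have sol: "solution_along m F G {0..1} \<gamma>t \<gamma>u (\<lambda>_. 0)" using l by blast
  show p: "path \<gamma>u"
    unfolding path_def by (rule solution_along_imp_time(1)[OF _ cont img sol]) simp
  have "(\<lambda>s. \<gamma>t s - \<Phi> (\<gamma>u s)) constant_on {0..1}"
    by (rule solution_along_imp_time(2)[OF _ cont img sol]) simp
  moreover have "\<gamma>t 0 = T + \<Phi> (\<gamma>u 0)"
    using blowup_time_unique[of L T "pathstart \<gamma>t" "pathstart \<gamma>u"] l L by (auto simp: pathstart_def)
  ultimately show time: "\<gamma>t s = T + \<Phi> (\<gamma>u s)" if "s \<in> {0..1}" for s
    using that unfolding constant_on_def
    by (metis add.commute add_diff_cancel_left' atLeastAtMost_iff diff_add_cancel order_refl zero_le_one)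
  have "winding_number \<gamma>t T = winding_number (\<lambda>s. T + \<Phi> (\<gamma>u s)) T"
    by (rule winding_number_cong) (simp add: time)
  then show "winding_number \<gamma>t T = of_nat (m - 1) * winding_number \<gamma>u 0"
    using winding_number_time[OF p] l L by (metis order_trans)
qed

text \<open>A competing blow-up loop has winding number \<open>(m - 1) n\<close> with an integer \<open>n\<close>, the winding number of its
\<open>u\<close>-component; if this is positive then \<open>n \<ge> 1\<close>.\<close>

lemma time_minimal_blowup_loop:
  assumes D: "open D" "connected D" "0 \<in> D" "D - {0} \<subseteq> ball 0 \<epsilon>"
    and \<gamma>: "path \<gamma>" "pathfinish \<gamma> = pathstart \<gamma>" "path_image \<gamma> \<subseteq> D - {0}" "winding_number \<gamma> 0 = 1"
  shows "minimal_blowup_loop m F G (D - {0}) T (\<lambda>s. T + \<Phi> (\<gamma> s)) \<gamma>"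
proof -
  have DB: "D \<subseteq> ball 0 \<epsilon>" using D(4) \<epsilon>_pos by force
  have img: "path_image \<gamma> \<subseteq> ball 0 \<epsilon> - {0}" using \<gamma>(3) DB by blast
  have wt: "winding_number (\<lambda>s. T + \<Phi> (\<gamma> s)) T = of_nat (m - 1)"
    using winding_number_time[OF \<gamma>(1,2) img] \<gamma>(4) by simp
  have cont: "continuous_on {0..1} \<gamma>" using \<gamma>(1) by (simp add: path_def)
  have in_B: "\<gamma> s \<in> ball 0 \<epsilon> - {0}" if "s \<in> {0..1}" for s
    using img that unfolding path_image_def by blast
  have "blowup_loop m F G (D - {0}) T (\<lambda>s. T + \<Phi> (\<gamma> s)) \<gamma>"
    unfolding blowup_loop_def
  proof (intro conjI)
    show "path (\<lambda>s. T + \<Phi> (\<gamma> s))"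
      unfolding path_def
      by (intro continuous_intros continuous_on_compose2[OF \<Phi>_cont cont]) (use in_B in auto)
    show "T \<notin> path_image (\<lambda>s. T + \<Phi> (\<gamma> s))"
      using \<Phi>_nz[OF in_B] by (auto simp: path_image_def)
    show "winding_number (\<lambda>s. T + \<Phi> (\<gamma> s)) T \<noteq> 0" using wt m_ge_2 by simp
    show "solution_along m F G {0..1} (\<lambda>s. T + \<Phi> (\<gamma> s)) \<gamma> (\<lambda>_. 0)"
      by (rule time_imp_solution_along[OF cont]) (use in_B in auto)
    have "\<gamma> 0 \<in> D - {0}" using \<gamma>(3) pathstart_in_path_image[of \<gamma>] by (auto simp: pathstart_def)
    then show "blows_up_at m F G (D - {0}) T (pathstart (\<lambda>s. T + \<Phi> (\<gamma> s))) (pathstart \<gamma>)"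
      using blows_up_at_time[OF D(1-3) DB] by (simp add: pathstart_def)
  qed (use \<gamma> in \<open>auto simp: pathstart_def pathfinish_def\<close>)
  moreover have "Re (winding_number (\<lambda>s. T + \<Phi> (\<gamma> s)) T) \<le> Re (winding_number \<gamma>t' T')"
    if loop: "blowup_loop m F G (D - {0}) T' \<gamma>t' \<gamma>u'" and pos: "0 < Re (winding_number \<gamma>t' T')"
    for T' \<gamma>t' \<gamma>u'
  proof -
    have "D - {0} \<subseteq> ball 0 \<epsilon> - {0}" using DB by blast
    note t = blowup_loop_time[OF loop this]
    have "winding_number \<gamma>u' 0 \<in> \<int>"
      using loop integer_winding_number[OF t(1)] unfolding blowup_loop_def by blast
    then obtain n :: int where n: "winding_number \<gamma>u' 0 = of_int n" by (auto elim: Ints_cases)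
    have Re: "Re (winding_number \<gamma>t' T') = real (m - 1) * real_of_int n"
      unfolding t(3) n by simp
    then have "n > 0" using pos by (simp add: zero_less_mult_iff)
    then have "1 \<le> real_of_int n" by simp
    then show ?thesis unfolding wt Re
      using mult_left_mono[of 1 "real_of_int n" "real (m - 1)"] by simp
  qed
  moreover have "0 < Re (winding_number (\<lambda>s. T + \<Phi> (\<gamma> s)) T)" using wt m_ge_2 by simp
  ultimately show ?thesis
    unfolding minimal_blowup_loop_def by blast
qed

end

text \<open>The origin is a zero of order \<open>m - 2\<close> of \<open>u\<^bsup>m-2\<^esup> / \<phi>(u)\<close>, since \<open>\<phi>(0) = \<lambda>\<^sub>1 \<noteq> 0\<close>.\<close>

lemma leaf_time_exists:
  assumes "m \<ge> 2" "l1 \<noteq> 0" and form: "blowup_form F G l1 l2 c2" and leaf: "trivial_leaf F G L"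
  obtains K \<phi> \<Phi> q \<epsilon> where "leaf_time m F G K \<phi> \<Phi> q \<epsilon>"
proof -
  obtain K where K: "\<And>u z. G u z = z * poly2 K u z"
    using trivial_leaf_imp_G_divisible[OF form leaf] by blast
  obtain P where P: "poly2 P 0 0 = 0" and F: "\<And>u z. F u z = u * (of_real l1 + poly2 P u z)"
    using form unfolding blowup_form_def by blast
  define \<phi> where "\<phi> u = of_real l1 + poly2 P u 0" for u
  have hol: "\<phi> holomorphic_on S" for S
    unfolding \<phi>_def by (intro holomorphic_intros holomorphic_on_poly2)
  have "\<phi> 0 \<noteq> 0" using P assms(2) by (simp add: \<phi>_def)
  moreover have "isCont \<phi> 0"
    using holomorphic_on_imp_continuous_on[OF hol[of UNIV]] by (simp add: continuous_on_eq_continuous_at)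
  ultimately obtain r where r: "r > 0" "\<And>u. u \<in> ball 0 r \<Longrightarrow> \<phi> u \<noteq> 0"
    using continuous_at_avoid[of 0 \<phi> 0] by (auto simp: dist_commute)
  have inv: "(\<lambda>u. 1 / \<phi> u) holomorphic_on ball 0 r"
    by (intro holomorphic_intros hol) (use r in auto)
  have "1 / \<phi> 0 \<noteq> 0" using \<open>\<phi> 0 \<noteq> 0\<close> by simp
  then obtain \<epsilon> \<Phi> q where \<epsilon>: "\<epsilon> > 0" "\<epsilon> \<le> r" "q holomorphic_on ball 0 \<epsilon>"
    and \<Phi>: "\<And>u. u \<in> ball 0 \<epsilon> \<Longrightarrow> (\<Phi> has_field_derivative u ^ (m - 2) * (1 / \<phi> u)) (at u)"
    "\<And>u. u \<in> ball 0 \<epsilon> \<Longrightarrow> \<Phi> u = u ^ Suc (m - 2) * exp (q u)"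
    by (rule primitive_with_zero_of_order[OF r(1) inv, where k = "m - 2"]) (rule that)
  have "Suc (m - 2) = m - 1" using assms(1) by simp
  then have "leaf_time m F G K \<phi> \<Phi> q \<epsilon>"
    by unfold_locales (use assms(1) \<epsilon> \<Phi> r(2) K F in \<open>auto simp: \<phi>_def\<close>)
  then show ?thesis by (rule that)
qed

section \<open>Minimal blow-up loops\<close>

theorem theorem8p1:
  fixes f g :: "complex poly poly" and m :: nat
    and e k c c2 :: complex and l1 l2 :: real
  defines "F \<equiv> field_u m f e k c" and "G \<equiv> field_z m f g e k c"
  assumes "m = vf_degree f g" and "m \<ge> 2"
    and "c \<noteq> 0"
    and "blowup_form F G l1 l2 c2"
    and "l1 < 0" and "l2 \<noteq> 0" and "l1 / l2 \<noteq> 1"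
    and "\<exists>L. trivial_leaf F G L"
  shows "\<exists>\<epsilon>>0. \<forall>L T \<gamma>u.
    trivial_leaf F G L \<and> L \<subseteq> ball 0 \<epsilon> \<and>
    path \<gamma>u \<and> pathfinish \<gamma>u = pathstart \<gamma>u \<and> path_image \<gamma>u \<subseteq> L \<and> winding_number \<gamma>u 0 = 1 \<longrightarrow>
    (\<exists>\<gamma>t. minimal_blowup_loop m F G L T \<gamma>t \<gamma>u \<and> winding_number \<gamma>t T = of_nat (m - 1) \<and>
      (\<forall>\<gamma>t'. blowup_loop m F G L T \<gamma>t' \<gamma>u \<longrightarrow> (\<forall>s\<in>{0..1}. \<gamma>t' s = \<gamma>t s)))"
proof -
  obtain K \<phi> \<Phi> q \<epsilon> where "leaf_time m F G K \<phi> \<Phi> q \<epsilon>"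
    using assms leaf_time_exists[of m l1 F G l2 c2] by (metis less_irrefl)
  then interpret leaf_time m F G K \<phi> \<Phi> q \<epsilon> .
  show ?thesis
  proof (intro exI[of _ \<epsilon>] conjI allI impI \<epsilon>_pos)
    fix L T \<gamma>u
    assume *: "trivial_leaf F G L \<and> L \<subseteq> ball 0 \<epsilon> \<and>
      path \<gamma>u \<and> pathfinish \<gamma>u = pathstart \<gamma>u \<and> path_image \<gamma>u \<subseteq> L \<and> winding_number \<gamma>u 0 = 1"
    then obtain D where D: "open D" "connected D" "0 \<in> D" "L = D - {0}"
      unfolding trivial_leaf_def by blast
    have L: "L \<subseteq> ball 0 \<epsilon> - {0}" using * D(4) by blast
    have "minimal_blowup_loop m F G L T (\<lambda>s. T + \<Phi> (\<gamma>u s)) \<gamma>u"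
      using time_minimal_blowup_loop[OF D(1-3)] * D(4) by blast
    moreover have "winding_number (\<lambda>s. T + \<Phi> (\<gamma>u s)) T = of_nat (m - 1)"
      using winding_number_time[of \<gamma>u T] * L by force
    ultimately show "\<exists>\<gamma>t. minimal_blowup_loop m F G L T \<gamma>t \<gamma>u \<and>
        winding_number \<gamma>t T = of_nat (m - 1) \<and>
        (\<forall>\<gamma>t'. blowup_loop m F G L T \<gamma>t' \<gamma>u \<longrightarrow> (\<forall>s\<in>{0..1}. \<gamma>t' s = \<gamma>t s))"
      using blowup_loop_time(2)[OF _ L] by blast
  qed
qed

end
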